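(* Let $k>0$ be an arbitrary time step size, let $u^0\in K$, and let $(u^n)_{n\ge 1}$ be the sequence in $K$ given by $u^n=\operatorname{argmin}_{u\in K} J_Q(u;u^{n-1})$ for $n=1,2,3,\ldots$. Then the energy $E$ is unconditionally stable, that is, without any constraint on the time step size $k$, for every $n\ge 1$, $$E(u^n)\leq E(u^{n-1}).$$
   Context: Let $\Omega\subset\mathbb{R}^d$, $d\in\{2,3\}$, be a domain and let $\epsilon>0$. Set $$K:=\{u\in H^1(\Omega) : |u|\le 1 \text{ a.e. in } \Omega\},$$ a nonempty closed convex subset of the real Sobolev space $H^1(\Omega)$. The energy functional of the Allen-Cahn equation $u_t-\Delta u+\frac{1}{\epsilon^2}u(u^2-1)=0$ is $$E(u):=\int_\Omega \frac12|\nabla u|^2+\frac{1}{\epsilon^2}F(u)\,\mathrm{d}x,\qquad F(u)=\frac14(u^2-1)^2 .$$ Put $p(u)=\frac12(u^2-1)$, so that $F(u)=p(u)^2$. For a given function $w$, let $p_L(u;w)$ be the linear expansion of $p$ at $w$, $$p_L(u;w)=p(w)+p'(w)(u-w)=wu-\frac12 w^2-\frac12 .$$ For a time step size $k>0$, define $$Q(u;w)=\frac12\|\nabla u\|_{L^2(\Omega)}^2+\frac1{2k}\|u-w\|_{L^2(\Omega)}^2,\qquad J_Q(u;w):=Q(u;w)+\frac1{\epsilon^2}\int_\Omega p_L(u;w)^2\,\mathrm{d}x .$$ Here $u^n=\operatorname{argmin}_{u\in K} J_Q(u;u^{n-1})$ means that $u^n\in K$ is the minimizer of $J_Q(\cdot;u^{n-1})$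 over $K$. *)

theory Defs
  imports "HOL-Analysis.Analysis"
begin

definition partial_deriv :: "'d::finite \<Rightarrow> (real ^ 'd \<Rightarrow> real) \<Rightarrow> real ^ 'd \<Rightarrow> real" where
  "partial_deriv i f x = frechet_derivative f (at x) (axis i 1)"

primrec Ck :: "nat \<Rightarrow> (real ^ 'd::finite \<Rightarrow> real) \<Rightarrow> bool" where
  "Ck 0 f \<longleftrightarrow> continuous_on UNIV f"
| "Ck (Suc m) f \<longleftrightarrow> (\<forall>x. f differentiable (at x)) \<and> (\<forall>i. Ck m (partial_deriv i f))"

definition test_functions :: "(real ^ 'd::finite) set \<Rightarrow> (real ^ 'd \<Rightarrow> real) set" where
  "test_functions \<Omega> =
     {\<phi>. (\<forall>m. Ck m \<phi>) \<and> compact (closure {x. \<phi> x \<noteq> 0}) \<and> closure {x. \<phi> x \<noteq> 0} \<subseteq> \<Omega>}"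

text \<open>Elements of the function spaces are represented by functions on the whole of R^d whose
  values outside \<open>\<Omega>\<close> are irrelevant, and without passing to classes modulo equality almost
  everywhere; all functionals below depend on that class only.\<close>

definition L2 :: "(real ^ 'd::finite) set \<Rightarrow> (real ^ 'd \<Rightarrow> 'b::euclidean_space) set" where
  "L2 \<Omega> = {f \<in> borel_measurable (lebesgue_on \<Omega>). integrable (lebesgue_on \<Omega>) (\<lambda>x. (norm (f x))\<^sup>2)}"

definition L2_norm :: "(real ^ 'd::finite) set \<Rightarrow> (real ^ 'd \<Rightarrow> 'b::euclidean_space) \<Rightarrow> real" where
  "L2_norm \<Omega> f = sqrt (LINT x|lebesgue_on \<Omega>. (norm (f x))\<^sup>2)"

text \<open>Only used for \<open>u\<close> and \<open>g\<close> in \<open>L2 \<Omega>\<close>, so that both integrals below converge.\<close>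

definition has_weak_gradient ::
    "(real ^ 'd::finite) set \<Rightarrow> (real ^ 'd \<Rightarrow> real) \<Rightarrow> (real ^ 'd \<Rightarrow> real ^ 'd) \<Rightarrow> bool" where
  "has_weak_gradient \<Omega> u g \<longleftrightarrow>
     (\<forall>\<phi>\<in>test_functions \<Omega>. \<forall>i.
        (LINT x|lebesgue_on \<Omega>. u x * partial_deriv i \<phi> x) = - (LINT x|lebesgue_on \<Omega>. g x $ i * \<phi> x))"

definition H1 :: "(real ^ 'd::finite) set \<Rightarrow> (real ^ 'd \<Rightarrow> real) set" where
  "H1 \<Omega> = {u \<in> L2 \<Omega>. \<exists>g\<in>L2 \<Omega>. has_weak_gradient \<Omega> u g}"

text \<open>For \<open>u \<in> H1 \<Omega>\<close> the weak gradient is unique up to equality almost everywhere in \<open>\<Omega>\<close>.\<close>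

definition weak_grad :: "(real ^ 'd::finite) set \<Rightarrow> (real ^ 'd \<Rightarrow> real) \<Rightarrow> real ^ 'd \<Rightarrow> real ^ 'd" where
  "weak_grad \<Omega> u = (SOME g. g \<in> L2 \<Omega> \<and> has_weak_gradient \<Omega> u g)"

definition K :: "(real ^ 'd::finite) set \<Rightarrow> (real ^ 'd \<Rightarrow> real) set" where
  "K \<Omega> = {u \<in> H1 \<Omega>. AE x in lebesgue_on \<Omega>. \<bar>u x\<bar> \<le> 1}"

definition F :: "real \<Rightarrow> real" where
  "F s = 1/4 * (s\<^sup>2 - 1)\<^sup>2"

definition p :: "real \<Rightarrow> real" where
  "p s = 1/2 * (s\<^sup>2 - 1)"

definition p_L :: "real \<Rightarrow> real \<Rightarrow> real" where
  "p_L s w = p w + deriv p w * (s - w)"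

lemma F_eq_p_squared: "F s = (p s)\<^sup>2"
  by (simp add: F_def p_def power_mult_distrib power2_eq_square)

lemma p_L_eq: "p_L s w = w * s - 1/2 * w\<^sup>2 - 1/2"
proof -
  have "(p has_field_derivative w) (at w)"
    unfolding p_def [abs_def] by (auto intro!: derivative_eq_intros)
  then have "deriv p w = w"
    by (rule DERIV_imp_deriv)
  then show ?thesis
    by (simp add: p_L_def p_def power2_eq_square field_simps)
qed

text \<open>\<open>\<Omega>\<close> may have infinite measure, and then the integral of \<open>F(u)\<close> is infinite for every
  \<open>u\<close> in \<open>L2 \<Omega>\<close>. Hence \<open>E\<close> and \<open>J_Q\<close>, whose integrands are nonnegative, take values in the
  extended nonnegative reals; a Bochner integral would be 0 instead of infinity.\<close>

definition E :: "(real ^ 'd::finite) set \<Rightarrow> real \<Rightarrow> (real ^ 'd \<Rightarrow> real) \<Rightarrow> ennreal" where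
  "E \<Omega> \<epsilon> u =
     (\<integral>\<^sup>+x. ennreal (1/2 * (norm (weak_grad \<Omega> u x))\<^sup>2 + 1/\<epsilon>\<^sup>2 * F (u x)) \<partial>lebesgue_on \<Omega>)"

definition Q :: "(real ^ 'd::finite) set \<Rightarrow> real \<Rightarrow> (real ^ 'd \<Rightarrow> real) \<Rightarrow> (real ^ 'd \<Rightarrow> real) \<Rightarrow> real" where
  "Q \<Omega> k u w =
     1/2 * (L2_norm \<Omega> (weak_grad \<Omega> u))\<^sup>2 + 1/(2*k) * (L2_norm \<Omega> (\<lambda>x. u x - w x))\<^sup>2"

definition J_Q ::
    "(real ^ 'd::finite) set \<Rightarrow> real \<Rightarrow> real \<Rightarrow> (real ^ 'd \<Rightarrow> real) \<Rightarrow> (real ^ 'd \<Rightarrow> real) \<Rightarrow> ennreal" where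
  "J_Q \<Omega> \<epsilon> k u w =
     ennreal (Q \<Omega> k u w) + ennreal (1/\<epsilon>\<^sup>2) * (\<integral>\<^sup>+x. ennreal ((p_L (u x) (w x))\<^sup>2) \<partial>lebesgue_on \<Omega>)"

end

theory Submission
  imports Defs
begin

text \<open>The linearised energy \<open>J_Q \<Omega> \<epsilon> k u w\<close>, as a functional of \<open>u\<close>, is a majorant of the
  energy \<open>E \<Omega> \<epsilon> u\<close> on \<open>K \<Omega>\<close> that touches it at \<open>u = w\<close>; a minimiser \<open>u\<close> therefore satisfies
  \<open>E u \<le> J_Q u w \<le> J_Q w w = E w\<close>, whatever the time step is.

  The majorisation is pointwise (\<open>F_le_p_L_squared\<close>). As \<open>p\<close> is convex, its tangent at \<open>w\<close>
  lies below it, and \<open>\<bar>u\<bar> \<le> 1\<close> means \<open>p u \<le> 0\<close>; so \<open>p_L u w \<le> p u \<le> 0\<close>, and squaring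
  reverses the order of nonpositive numbers: \<open>F u = (p u)\<^sup>2 \<le> (p_L u w)\<^sup>2\<close>. Thus the bound
  \<open>\<bar>u\<bar> \<le> 1\<close> does what a restriction of the time step would otherwise have to do. The quadratic
  penalty with factor \<open>1/(2*k)\<close> in \<open>Q\<close> is nonnegative and vanishes at \<open>u = w\<close>, so it disturbs
  neither the majorisation (\<open>E_le_J_Q\<close>) nor the contact (\<open>J_Q_self\<close>).\<close>

text \<open>The Taylor expansion of the quadratic \<open>p\<close> is exact; its nonnegative remainder puts the
  tangent below \<open>p\<close>.\<close>

lemma p_eq_p_L_plus_square: "p s = p_L s w + (s - w)\<^sup>2 / 2"
  by (simp add: p_def p_L_eq power2_eq_square field_simps)

lemma p_L_self: "p_L w w = p w"
  by (simp add: p_L_def)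

lemma p_nonpos:
  assumes "\<bar>s\<bar> \<le> 1"
  shows "p s \<le> 0"
  using abs_square_le_1[of s] assms by (simp add: p_def)

lemma F_le_p_L_squared:
  assumes "\<bar>s\<bar> \<le> 1"
  shows "F s \<le> (p_L s w)\<^sup>2"
proof -
  have "p_L s w \<le> p s"
    by (simp add: p_eq_p_L_plus_square[of s w])
  then have "\<bar>p s\<bar> \<le> \<bar>p_L s w\<bar>"
    using p_nonpos[OF assms] by simp
  then show ?thesis
    unfolding F_eq_p_squared by (simp add: abs_le_square_iff)
qed

lemma weak_grad_in_L2:
  assumes "u \<in> H1 \<Omega>"
  shows "weak_grad \<Omega> u \<in> L2 \<Omega>"
proof -
  have "\<exists>g. g \<in> L2 \<Omega> \<and> has_weak_gradient \<Omega> u g"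
    using assms by (auto simp: H1_def)
  from someI_ex[OF this] show ?thesis
    by (simp add: weak_grad_def)
qed

text \<open>The single integral in \<open>E\<close> separates even when its potential part is infinite. This form
  of \<open>E\<close> has the same shape as \<open>J_Q\<close>, so that the two can be compared term by term.\<close>

lemma E_eq_gradient_plus_potential:
  assumes "u \<in> H1 \<Omega>"
  shows "E \<Omega> \<epsilon> u = ennreal (1/2 * (L2_norm \<Omega> (weak_grad \<Omega> u))\<^sup>2)
     + ennreal (1/\<epsilon>\<^sup>2) * (\<integral>\<^sup>+x. ennreal (F (u x)) \<partial>lebesgue_on \<Omega>)"
proof -
  let ?g = "weak_grad \<Omega> u"
  have g [measurable]: "?g \<in> borel_measurable (lebesgue_on \<Omega>)"
    and gi: "integrable (lebesgue_on \<Omega>) (\<lambda>x. (norm (?g x))\<^sup>2)"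
    using weak_grad_in_L2[OF assms] by (auto simp: L2_def)
  have u [measurable]: "u \<in> borel_measurable (lebesgue_on \<Omega>)"
    using assms by (auto simp: H1_def L2_def)
  have F_nonneg: "0 \<le> F s" for s
    by (simp add: F_def)
  have Fu [measurable]: "(\<lambda>x. F (u x)) \<in> borel_measurable (lebesgue_on \<Omega>)"
    unfolding F_def by measurable
  have "E \<Omega> \<epsilon> u = (\<integral>\<^sup>+x. ennreal (1/2 * (norm (?g x))\<^sup>2) + ennreal (1/\<epsilon>\<^sup>2) * ennreal (F (u x))
      \<partial>lebesgue_on \<Omega>)"
    unfolding E_def
    by (intro nn_integral_cong) (simp add: F_nonneg flip: ennreal_mult ennreal_plus)
  also have "\<dots> = (\<integral>\<^sup>+x. ennreal (1/2 * (norm (?g x))\<^sup>2) \<partial>lebesgue_on \<Omega>)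
      + ennreal (1/\<epsilon>\<^sup>2) * (\<integral>\<^sup>+x. ennreal (F (u x)) \<partial>lebesgue_on \<Omega>)"
    by (simp add: nn_integral_add nn_integral_cmult)
  also have "(\<integral>\<^sup>+x. ennreal (1/2 * (norm (?g x))\<^sup>2) \<partial>lebesgue_on \<Omega>)
      = ennreal (1/2 * (L2_norm \<Omega> ?g)\<^sup>2)"
    using gi by (subst nn_integral_eq_integral) (auto simp: L2_norm_def integral_nonneg)
  finally show ?thesis .
qed

lemma E_le_J_Q:
  assumes u: "u \<in> K \<Omega>" and "k > 0"
  shows "E \<Omega> \<epsilon> u \<le> J_Q \<Omega> \<epsilon> k u w"
proof -
  have "AE x in lebesgue_on \<Omega>. \<bar>u x\<bar> \<le> 1"
    using u by (simp add: K_def)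
  then have "(\<integral>\<^sup>+x. ennreal (F (u x)) \<partial>lebesgue_on \<Omega>)
      \<le> (\<integral>\<^sup>+x. ennreal ((p_L (u x) (w x))\<^sup>2) \<partial>lebesgue_on \<Omega>)"
    by (intro nn_integral_mono_AE) (auto elim!: eventually_mono intro!: ennreal_leI F_le_p_L_squared)
  moreover have "1/2 * (L2_norm \<Omega> (weak_grad \<Omega> u))\<^sup>2 \<le> Q \<Omega> k u w"
    using \<open>k > 0\<close> by (simp add: Q_def)
  ultimately show ?thesis
    using u unfolding J_Q_def
    by (subst E_eq_gradient_plus_potential) (auto simp: K_def intro!: add_mono mult_left_mono ennreal_leI)
qed

lemma J_Q_self:
  assumes "w \<in> H1 \<Omega>"
  shows "J_Q \<Omega> \<epsilon> k w w = E \<Omega> \<epsilon> w"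
  unfolding E_eq_gradient_plus_potential[OF assms]
  by (simp add: J_Q_def Q_def p_L_self L2_norm_def F_eq_p_squared)

theorem theorem4p1:
  fixes \<Omega> :: "(real ^ 'd::finite) set"
    and \<epsilon> k :: real
    and u :: "nat \<Rightarrow> real ^ 'd \<Rightarrow> real"
  assumes "CARD('d) \<in> {2, 3}"
    and "open \<Omega>" and "connected \<Omega>" and "\<Omega> \<noteq> {}"
    and "\<epsilon> > 0"
    and "k > 0"
    and "u 0 \<in> K \<Omega>"
    and "\<forall>n\<ge>1. is_arg_min (\<lambda>v. J_Q \<Omega> \<epsilon> k v (u (n - 1))) (\<lambda>v. v \<in> K \<Omega>) (u n)"
  shows "\<forall>n\<ge>1. E \<Omega> \<epsilon> (u n) \<le> E \<Omega> \<epsilon> (u (n - 1))"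
proof (intro allI impI)
  fix n :: nat
  assume n: "n \<ge> 1"
  have in_K: "u m \<in> K \<Omega>" for m
    using assms(7,8) by (cases m) (auto simp: is_arg_min_def)
  have "E \<Omega> \<epsilon> (u n) \<le> J_Q \<Omega> \<epsilon> k (u n) (u (n - 1))"
    using in_K \<open>k > 0\<close> by (rule E_le_J_Q)
  also have "\<dots> \<le> J_Q \<Omega> \<epsilon> k (u (n - 1)) (u (n - 1))"
    using assms(8) n in_K by (auto simp: is_arg_min_linorder)
  also have "\<dots> = E \<Omega> \<epsilon> (u (n - 1))"
    using in_K by (intro J_Q_self) (auto simp: K_def)
  finally show "E \<Omega> \<epsilon> (u n) \<le> E \<Omega> \<epsilon> (u (n - 1))" .
qed

end
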